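(* Let $v \in \mathbf{A}^{r\times n}$ be any $r$-by-$n$ matrix. A matrix $w \in \mathbf{A}^{r\times n}$, with columns $w_1,\dots,w_n$, lies in $X_v$ if and only if for every nonempty subset $J=\{j_1<\dots<j_\ell\}\subset\{1,\dots,n\}$ the family of tensors $$w_{j_i}\otimes (v_J^\perp)_i \in \mathbf{k}^r\otimes \mathbf{k}^{\ell-\operatorname{rk}(v_J)},\qquad i=1,\dots,\ell,$$ is linearly dependent.
   Context: $\mathbf{k}$ is an algebraically closed field of characteristic zero, and $\mathbf{A}^{r\times n}$ is the affine space of $r$-by-$n$ matrices over $\mathbf{k}$. The group $G=\mathrm{GL}_r(\mathbf{k})\times(\mathbf{k}^\times)^n$ acts on $\mathbf{A}^{r\times n}$, the first factor by left multiplication and the second by rescaling columns (right multiplication by diagonal matrices). $X_v$ denotes the Zariski closure of the orbit $G\cdot v$ in $\mathbf{A}^{r\times n}$. For $J=\{j_1<\dots<j_\ell\}$, $v_J$ is the $r$-by-$\ell$ submatrix of $v$ on the columns indexed by $J$. A Gale dual $v_J^\perp$ of $v_J$ is any $(\ell-\operatorname{rk}(v_J))$-by-$\ell$ matrix whose rows form a basis of the right kernel of $v_J$; $(v_J^\perp)_i$ is its $i$-th column. (The condition does not depend on the choice of $v_J^\perp$.) If the columns of $v_J$ are linearly independent, the columns $(v_J^\perp)_i$ are null vectors and all the tensors are interpreted as zero, so the family is linearly dependent. Linear dependence is that of an indexed family of $\ell$ vectors. *)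

theory Defs
  imports
    "HOL-Library.Poly_Mapping"
    "HOL-Computational_Algebra.Polynomial"
    "Jordan_Normal_Form.Matrix_Kernel"
    "Jordan_Normal_Form.DL_Rank"
    "Jordan_Normal_Form.DL_Submatrix"
begin

text \<open>
  Affine space of \<open>r\<close>-by-\<open>n\<close> matrices is \<open>carrier_mat r n\<close>; rows and columns are numbered from 0.
  Its coordinate ring is the ring of polynomials in the variables \<open>(i, j)\<close> with \<open>i < r\<close> and
  \<open>j < n\<close>: a polynomial is a finitely supported map from monomials to coefficients, a monomial
  a finitely supported map from variables to exponents.
\<close>

type_synonym 'a entry_poly = "((nat \<times> nat) \<Rightarrow>\<^sub>0 nat) \<Rightarrow>\<^sub>0 'a"

definition entry_polys :: "nat \<Rightarrow> nat \<Rightarrow> ('a :: zero) entry_poly set" where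
  "entry_polys r n = {p. \<forall>m \<in> Poly_Mapping.keys p. Poly_Mapping.keys m \<subseteq> {0..<r} \<times> {0..<n}}"

definition eval_entry_poly :: "('a :: comm_semiring_1) entry_poly \<Rightarrow> 'a mat \<Rightarrow> 'a" where
  "eval_entry_poly p x =
     (\<Sum>m \<in> Poly_Mapping.keys p. Poly_Mapping.lookup p m *
        (\<Prod>ij \<in> Poly_Mapping.keys m. (x $$ ij) ^ Poly_Mapping.lookup m ij))"

definition zariski_closed :: "nat \<Rightarrow> nat \<Rightarrow> ('a :: comm_semiring_1) mat set \<Rightarrow> bool" where
  "zariski_closed r n Z \<longleftrightarrow>
     (\<exists>P \<subseteq> entry_polys r n. Z = {x \<in> carrier_mat r n. \<forall>p \<in> P. eval_entry_poly p x = 0})"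

definition zariski_closure :: "nat \<Rightarrow> nat \<Rightarrow> ('a :: comm_semiring_1) mat set \<Rightarrow> 'a mat set" where
  "zariski_closure r n S = \<Inter> {Z. zariski_closed r n Z \<and> S \<subseteq> Z}"

definition matrix_orbit :: "nat \<Rightarrow> nat \<Rightarrow> ('a :: field) mat \<Rightarrow> 'a mat set" where
  "matrix_orbit r n v =
     {g * v * mat_diag n t | g t. g \<in> carrier_mat r r \<and> invertible_mat g \<and> (\<forall>j<n. t j \<noteq> 0)}"

definition matrix_orbit_closure :: "nat \<Rightarrow> nat \<Rightarrow> ('a :: field) mat \<Rightarrow> 'a mat set" where
  "matrix_orbit_closure r n v = zariski_closure r n (matrix_orbit r n v)"

definition column_submatrix :: "'a mat \<Rightarrow> nat set \<Rightarrow> 'a mat" where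
  "column_submatrix v J = submatrix v UNIV J"

definition mat_rank :: "('a :: field) mat \<Rightarrow> nat" where
  "mat_rank A = vec_space.rank (dim_row A) A"

text \<open>
  The rows of \<open>B\<close>, as an indexed family, form a basis of the right kernel of \<open>A\<close>. The
  distinctness condition is needed since \<open>kernel.basis\<close> speaks about the set of rows only.
\<close>

definition gale_dual :: "('a :: field) mat \<Rightarrow> 'a mat \<Rightarrow> bool" where
  "gale_dual A B \<longleftrightarrow>
     B \<in> carrier_mat (dim_col A - mat_rank A) (dim_col A) \<and>
     distinct (rows B) \<and> kernel.basis (dim_col A) A (set (rows B))"

lemma gale_dual_exists:
  assumes A: "(A :: 'a :: field mat) \<in> carrier_mat nr nc"
  shows "\<exists>B. gale_dual A B"
proof -
  interpret K: kernel nr nc A by (unfold_locales, rule A)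
  interpret W: vec_space "TYPE('a)" nr .
  have lin: "linear_map class_ring K.NC.V W.V ((*\<^sub>v) A)"
  proof (intro linear_map.intro mod_hom.intro)
    show "vectorspace class_ring K.NC.V" "vectorspace class_ring W.V"
      by (rule K.NC.vectorspace_axioms W.vectorspace_axioms)+
    show "Module.module class_ring K.NC.V" "Module.module class_ring W.V"
      by (rule K.NC.module_axioms W.module_axioms)+
    show "mod_hom_axioms class_ring K.NC.V W.V ((*\<^sub>v) A)"
      unfolding mod_hom_axioms_def LinearCombinations.module_hom_def module_vec_simps class_ring_simps
      using A mult_add_distrib_mat_vec[OF A] mult_mat_vec[OF A] by auto
  qed
  interpret L: linear_map class_ring K.NC.V W.V "(*\<^sub>v) A" by (rule lin)
  have ker: "L.kerT = mat_kernel A"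
    using A unfolding L.ker_def mat_kernel_def by (auto simp: module_vec_simps)
  have im: "L.imT = W.span (set (cols A))"
    using A unfolding L.im_def W.col_space_eq[OF A, unfolded W.col_space_def]
    by (auto simp: module_vec_simps)
  have "W.rank A + K.dim = nc"
    using L.rank_nullity[OF K.NC.fin_dim] unfolding ker im W.rank_def K.NC.dim_is_n by simp
  obtain S where S: "finite S" "K.basis S" using kernel_basis_exists[OF A] by blast
  have "K.dim = card S" by (rule K.Ker.dim_basis[OF S])
  obtain xs where xs: "set xs = S" "distinct xs" using finite_distinct_list[OF S(1)] by blast
  have sub: "S \<subseteq> carrier_vec nc"
    using S(2) mat_kernel_carrier[OF A] unfolding K.Ker.basis_def by auto
  have len: "length xs = nc - W.rank A"
    using \<open>W.rank A + K.dim = nc\<close> \<open>K.dim = card S\<close> xs distinct_card by fastforce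
  have rows: "rows (mat_of_rows nc xs) = xs" using sub xs by (intro rows_mat_of_rows) auto
  have dims: "dim_row A = nr" "dim_col A = nc" using A by auto
  have "gale_dual A (mat_of_rows nc xs)"
    unfolding gale_dual_def mat_rank_def rows dims using len xs S by auto
  then show ?thesis ..
qed

text \<open>
  The pure tensor in coordinates: the tensor product of the spaces of dimensions \<open>r\<close> and \<open>m\<close> is
  identified with the space of dimension \<open>r * m\<close>, the product of the basis vectors numbered \<open>i\<close>
  and \<open>k\<close> being the basis vector numbered \<open>i * m + k\<close>. If \<open>m = 0\<close> this is the zero space.
\<close>

definition vec_tensor :: "('a :: semiring_0) vec \<Rightarrow> 'a vec \<Rightarrow> 'a vec" where
  "vec_tensor x y =
     vec (dim_vec x * dim_vec y) (\<lambda>k. x $ (k div dim_vec y) * y $ (k mod dim_vec y))"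

text \<open>
  Dependence of an indexed family of vectors of dimension \<open>d\<close>; repeated vectors make it dependent,
  unlike for \<open>lin_dep\<close>, which is about sets.
\<close>

definition lin_dep_family :: "nat \<Rightarrow> ('a :: field) vec list \<Rightarrow> bool" where
  "lin_dep_family d xs \<longleftrightarrow>
     (\<exists>c. (\<exists>i<length xs. c i \<noteq> 0) \<and> module.lincomb_list (module_vec TYPE('a) d) c xs = 0\<^sub>v d)"

definition tensor_family :: "('a :: field) mat \<Rightarrow> nat set \<Rightarrow> 'a mat \<Rightarrow> 'a vec list" where
  "tensor_family w J B = map (\<lambda>i. vec_tensor (col w (pick J i)) (col B i)) [0..<card J]"

end

theory Submission
  imports Defs "Jordan_Normal_Form.Char_Poly"
begin

text \<open>
  Gale duality removes the tensors. The entries of \<open>\<Sum>i. c i * (w\<^sub>i \<otimes> B\<^sub>i)\<close>, the sum running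
  over the columns in \<open>J\<close>, are the products of the rows of \<open>w\<^sub>J diag(c)\<close> with the rows of \<open>B\<close>.
  The rows of \<open>B\<close> span the kernel of \<open>v\<^sub>J\<close>, and what is orthogonal to this kernel is the row space
  of \<open>v\<^sub>J\<close>. Hence a relation with coefficients \<open>c\<close> exists exactly if \<open>w\<^sub>J diag(c) = g v\<^sub>J\<close> for some
  square matrix \<open>g\<close>, possibly singular. This is the predicate \<open>aligned_on\<close>, where \<open>c\<close> must
  have a nonzero entry on \<open>J\<close>, and the equivalence is \<open>lin_dep_tensor_family_iff\<close>.

  Every point \<open>g v diag(t)\<close> of the orbit is aligned with \<open>v\<close> on every nonempty \<open>J\<close>: take \<open>c = 1/t\<close>. The
  tensors depend polynomially on \<open>w\<close>, and linear dependence of vectors that vary polynomially is a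
  closed condition (\<open>linear_dependence_closed\<close>), so it persists on the orbit closure.

  Conversely, let \<open>w\<close> be aligned with \<open>v\<close> on every nonempty \<open>J\<close>. Start with all columns and with
  \<open>c\<^sub>0, g\<^sub>0\<close> for them. On the support \<open>S\<^sub>0\<close> of \<open>c\<^sub>0\<close> the columns of \<open>w\<close> are multiples of those of
  \<open>g\<^sub>0 v\<close>, and \<open>g\<^sub>0\<close> kills the other columns of \<open>v\<close>. Alignment on the complement of \<open>S\<^sub>0\<close> gives
  \<open>c\<^sub>1, g\<^sub>1\<close> with support \<open>S\<^sub>1\<close>, and so on until the columns are exhausted. Put
  \<open>G(s) = g\<^sub>0 + s g\<^sub>1 + s\<^sup>2 g\<^sub>2 + \<dots>\<close>. For \<open>j\<close> in \<open>S\<^sub>k\<close> the first \<open>k\<close> terms kill the column \<open>v\<^sub>j\<close>, so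
  \<open>G(s) v\<^sub>j\<close> divided by \<open>c\<^sub>k(j) s\<^sup>k\<close> is polynomial in \<open>s\<close> and has the value \<open>w\<^sub>j\<close> at \<open>s = 0\<close>
  (\<open>degeneration_if_aligned\<close>). This is a polynomial curve through \<open>w\<close> whose other points have the
  form \<open>g v diag(t)\<close> with all \<open>t\<^sub>j\<close> nonzero and \<open>g\<close> arbitrary. Such a point is in turn on the line of the
  \<open>(g + s I) v diag(t)\<close>, all but finitely many of whose points are in the orbit
  (\<open>eval_zero_on_translate\<close>). A polynomial that vanishes on the orbit therefore vanishes along the
  line and then along the curve, in particular at \<open>w\<close>.
\<close>

section \<open>Gale duality and row spaces\<close>

text \<open>
  A linear form that vanishes on the common kernel of finitely many forms is a combination of
  them. The induction step is trivial if the last form \<open>a m\<close> vanishes on the common kernel of the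
  others. Otherwise choose \<open>z0\<close> in that kernel with value 1 under \<open>a m\<close>. Translating along \<open>z0\<close>
  moves a common zero of the others into the kernel of \<open>a m\<close>, so subtracting from \<open>x\<close> the right
  multiple of \<open>a m\<close> reduces to fewer forms.
\<close>

lemma in_span_if_vanishes_on_common_kernel:
  fixes a :: "nat \<Rightarrow> 'i \<Rightarrow> 'a :: field"
  assumes I: "finite I"
    and "\<And>z. \<forall>k<m. (\<Sum>i\<in>I. a k i * z i) = 0 \<Longrightarrow> (\<Sum>i\<in>I. x i * z i) = 0"
  shows "\<exists>y. \<forall>i\<in>I. x i = (\<Sum>k<m. y k * a k i)"
  using assms(2)
proof (induction m arbitrary: x)
  case 0
  have "x i = 0" if "i \<in> I" for i
    using 0[of "\<lambda>l. if l = i then 1 else 0"] that I by (simp add: if_distrib cong: if_cong)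
  then show ?case by simp
next
  case (Suc m)
  show ?case
  proof (cases "\<forall>z. (\<forall>k<m. (\<Sum>i\<in>I. a k i * z i) = 0) \<longrightarrow> (\<Sum>i\<in>I. a m i * z i) = 0")
    case True
    then obtain y where y: "\<forall>i\<in>I. x i = (\<Sum>k<m. y k * a k i)"
      using Suc.IH[of x] Suc.prems by (metis less_Suc_eq)
    then show ?thesis by (intro exI[of _ "y(m := 0)"]) simp
  next
    case False
    then obtain z1 where z1: "\<forall>k<m. (\<Sum>i\<in>I. a k i * z1 i) = 0" "(\<Sum>i\<in>I. a m i * z1 i) \<noteq> 0"
      unfolding not_all not_imp by (elim exE conjE)
    define z0 where "z0 = (\<lambda>i. z1 i / (\<Sum>i\<in>I. a m i * z1 i))"
    have scale: "(\<Sum>i\<in>I. f i * z0 i) = (\<Sum>i\<in>I. f i * z1 i) / (\<Sum>i\<in>I. a m i * z1 i)" for f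
      unfolding z0_def by (simp add: sum_divide_distrib)
    have z0: "\<forall>k<m. (\<Sum>i\<in>I. a k i * z0 i) = 0" "(\<Sum>i\<in>I. a m i * z0 i) = 1"
      using z1 by (simp_all add: scale)
    define s where "s = (\<Sum>i\<in>I. x i * z0 i)"
    have "\<exists>y. \<forall>i\<in>I. x i - s * a m i = (\<Sum>k<m. y k * a k i)"
    proof (rule Suc.IH)
      fix z assume z: "\<forall>k<m. (\<Sum>i\<in>I. a k i * z i) = 0"
      define u where "u = (\<Sum>i\<in>I. a m i * z i)"
      have lin: "(\<Sum>i\<in>I. f i * (z i - u * z0 i)) = (\<Sum>i\<in>I. f i * z i) - u * (\<Sum>i\<in>I. f i * z0 i)"
        for f by (simp add: algebra_simps sum_subtractf sum_distrib_left)
      have "(\<Sum>i\<in>I. x i * (z i - u * z0 i)) = 0"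
        by (rule Suc.prems) (use z z0 in \<open>auto simp: lin less_Suc_eq simp flip: u_def\<close>)
      then have "(\<Sum>i\<in>I. x i * z i) = u * s" by (simp add: lin s_def)
      then show "(\<Sum>i\<in>I. (x i - s * a m i) * z i) = 0"
        by (simp add: left_diff_distrib sum_subtractf mult.assoc mult.commute[of s u] u_def
            flip: sum_distrib_left)
    qed
    then obtain y where y: "\<forall>i\<in>I. x i - s * a m i = (\<Sum>k<m. y k * a k i)" by blast
    then show ?thesis
      by (intro exI[of _ "y(m := s)"]) (simp add: algebra_simps)
  qed
qed

text \<open>
  Orthogonality to a basis of the kernel is orthogonality to the kernel, and the orthogonal
  complement of the kernel is the row space.
\<close>

lemma annihilates_gale_dual_iff:
  assumes A: "A \<in> carrier_mat r l" and gale: "gale_dual A B"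
  shows "(\<forall>k<dim_row B. (\<Sum>i<l. x i * B $$ (k, i)) = 0) \<longleftrightarrow>
    (\<exists>y. \<forall>i<l. x i = (\<Sum>b<r. y b * A $$ (b, i)))"
proof
  interpret K: kernel r l A by unfold_locales (rule A)
  have B: "dim_col B = l" and basis: "K.basis (set (rows B))" and dist: "distinct (rows B)"
    using gale A unfolding gale_dual_def by auto
  have ker: "set (rows B) \<subseteq> mat_kernel A" and gen: "K.span (set (rows B)) = mat_kernel A"
    using basis unfolding K.Ker.basis_def by auto
  have A_B: "(\<Sum>i<l. A $$ (b, i) * B $$ (k, i)) = 0" if "b < r" "k < dim_row B" for b k
  proof -
    have "row B k \<in> mat_kernel A" using ker that by (auto simp: rows_def)
    then have "(A *\<^sub>v row B k) $ b = 0" using mat_kernelD[OF A] that by simp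
    then show ?thesis
      using that A B by (simp add: scalar_prod_def lessThan_atLeast0)
  qed
  {
    assume x: "\<forall>k<dim_row B. (\<Sum>i<l. x i * B $$ (k, i)) = 0"
    have "\<exists>y. \<forall>i\<in>{..<l}. x i = (\<Sum>b<r. y b * A $$ (b, i))"
    proof (rule in_span_if_vanishes_on_common_kernel)
      fix z assume z: "\<forall>b<r. (\<Sum>i<l. A $$ (b, i) * z i) = 0"
      have "A *\<^sub>v vec l z = 0\<^sub>v r"
        using A z by (intro eq_vecI) (auto simp: scalar_prod_def lessThan_atLeast0)
      then have "vec l z \<in> K.NC.span (set (rows B))"
        using mat_kernelI[OF A] K.span_same[OF ker] gen by simp
      then have "\<exists>c. K.NC.lincomb c (set (rows B)) = vec l z"
        using K.NC.finite_in_span[of "set (rows B)" "vec l z"]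
          subset_trans[OF ker mat_kernel_carrier[OF A]] by auto
      then obtain c where c: "vec l z = K.NC.lincomb c (set (rows B))" by (elim exE) (rule that, rule sym)
      have "z i = (\<Sum>k<dim_row B. c (row B k) * B $$ (k, i))" if "i < l" for i
      proof -
        have "z i = vec l z $ i" using that by simp
        also have "\<dots> = (\<Sum>b\<in>set (rows B). c b * b $ i)"
          unfolding c using ker mat_kernel_carrier[OF A] that by (subst K.NC.lincomb_index) auto
        also have "\<dots> = (\<Sum>k<dim_row B. c (row B k) * row B k $ i)"
          using dist by (simp add: rows_def distinct_map sum.reindex lessThan_atLeast0)
        finally show ?thesis using that B by simp
      qed
      then have "(\<Sum>i<l. x i * z i) = (\<Sum>i<l. \<Sum>k<dim_row B. c (row B k) * (x i * B $$ (k, i)))"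
        by (intro sum.cong refl) (simp add: sum_distrib_left mult.left_commute)
      also have "\<dots> = (\<Sum>k<dim_row B. c (row B k) * (\<Sum>i<l. x i * B $$ (k, i)))"
        by (subst sum.swap) (simp add: sum_distrib_left)
      finally show "(\<Sum>i<l. x i * z i) = 0" using x by simp
    qed simp
    then show "\<exists>y. \<forall>i<l. x i = (\<Sum>b<r. y b * A $$ (b, i))" by auto
  }
  assume "\<exists>y. \<forall>i<l. x i = (\<Sum>b<r. y b * A $$ (b, i))"
  then obtain y where y: "\<forall>i<l. x i = (\<Sum>b<r. y b * A $$ (b, i))" by blast
  show "\<forall>k<dim_row B. (\<Sum>i<l. x i * B $$ (k, i)) = 0"
  proof (intro allI impI)
    fix k assume k: "k < dim_row B"
    have "(\<Sum>i<l. x i * B $$ (k, i)) = (\<Sum>i<l. \<Sum>b<r. y b * (A $$ (b, i) * B $$ (k, i)))"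
      using y by (intro sum.cong refl) (simp add: sum_distrib_right mult.assoc)
    also have "\<dots> = (\<Sum>b<r. y b * (\<Sum>i<l. A $$ (b, i) * B $$ (k, i)))"
      by (subst sum.swap) (simp add: sum_distrib_left)
    also have "\<dots> = 0" using k A_B by simp
    finally show "(\<Sum>i<l. x i * B $$ (k, i)) = 0" .
  qed
qed

lemma lin_dep_family_iff:
  assumes "\<forall>x\<in>set xs. dim_vec x = d"
  shows "lin_dep_family d xs \<longleftrightarrow>
    (\<exists>c. (\<exists>i<length xs. c i \<noteq> 0) \<and> (\<forall>k<d. (\<Sum>i<length xs. c i * xs ! i $ k) = 0))"
proof -
  interpret vec_module "TYPE('a)" d .
  have "lincomb_list c xs $ k = (\<Sum>i<length xs. c i * xs ! i $ k)" if "k < d" for c k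
    using that assms unfolding lincomb_list_as_mat_mult[OF assms]
    by (simp add: scalar_prod_def mat_of_cols_def lessThan_atLeast0 mult.commute)
  moreover have "dim_vec (lincomb_list c xs) = d" for c
    unfolding lincomb_list_as_mat_mult[OF assms] by simp
  ultimately have "lincomb_list c xs = 0\<^sub>v d \<longleftrightarrow> (\<forall>k<d. (\<Sum>i<length xs. c i * xs ! i $ k) = 0)" for c
    by (metis (no_types, lifting) eq_vecI index_zero_vec)
  then show ?thesis unfolding lin_dep_family_def by simp
qed

text \<open>
  In matrix form \<open>w\<^sub>J diag(c) = g v\<^sub>J\<close>, where \<open>c\<close> is not the zero vector on \<open>J\<close>. The columns of \<open>w\<close>
  where \<open>c\<close> vanishes are unconstrained; instead \<open>g\<close> must kill the corresponding columns of \<open>v\<close>.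
\<close>

definition aligned_on :: "nat \<Rightarrow> ('a :: field) mat \<Rightarrow> 'a mat \<Rightarrow> nat set \<Rightarrow> bool" where
  "aligned_on r v w J \<longleftrightarrow> (\<exists>c g. (\<exists>j\<in>J. c j \<noteq> 0) \<and>
     (\<forall>j\<in>J. \<forall>a<r. c j * w $$ (a, j) = (\<Sum>b<r. g a b * v $$ (b, j))))"

lemma tensor_family_index:
  assumes "dim_row w = r" and "i < card J" and "pick J i < dim_col w" and "i < dim_col B"
    and "k < r * dim_row B"
  shows "tensor_family w J B ! i $ k
    = w $$ (k div dim_row B, pick J i) * B $$ (k mod dim_row B, i)"
proof -
  have "0 < dim_row B" using assms(5) by (cases "dim_row B") auto
  moreover have "k div dim_row B < r" using assms(5) by (simp add: less_mult_imp_div_less)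
  ultimately show ?thesis using assms by (simp add: tensor_family_def vec_tensor_def)
qed

text \<open>
  For fixed coefficients \<open>c\<close>, the coordinates of the relation belonging to row \<open>a\<close> of \<open>w\<close> say that
  row \<open>a\<close> of \<open>w\<^sub>J diag(c)\<close> annihilates the Gale dual, hence lies in the row space of \<open>v\<^sub>J\<close>. The
  coefficients of its expression by the rows of \<open>v\<^sub>J\<close> are row \<open>a\<close> of \<open>g\<close>.
\<close>

lemma lin_dep_tensor_family_iff:
  assumes v: "v \<in> carrier_mat r n" and w: "w \<in> carrier_mat r n" and J: "J \<subseteq> {0..<n}"
    and gale: "gale_dual (column_submatrix v J) B"
  shows "lin_dep_family (r * dim_row B) (tensor_family w J B) \<longleftrightarrow> aligned_on r v w J"
proof -
  let ?l = "card J"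
  have fin: "finite J" using J finite_subset by blast
  have sub: "{j. j < n \<and> j \<in> J} = J" using J by auto
  have A: "column_submatrix v J \<in> carrier_mat r ?l"
    using v by (auto simp: column_submatrix_def submatrix_def sub intro!: carrier_matI)
  have A_index: "column_submatrix v J $$ (b, i) = v $$ (b, pick J i)" if "b < r" "i < ?l" for b i
    unfolding column_submatrix_def using that v by (subst submatrix_index) (auto simp: sub pick_UNIV)
  have B: "dim_col B = ?l" using gale A unfolding gale_dual_def by auto
  have pick: "pick J i \<in> J" if "i < ?l" for i
    using that by (simp add: pick_in_set_le)
  have surj: "\<exists>i<?l. j = pick J i" if "j \<in> J" for j
  proof -
    have "{a\<in>J. a < j} \<subset> J" using that by blast
    then show ?thesis using pick_card_in_set[OF that] psubset_card_mono[OF fin] by metis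
  qed
  let ?dep = "\<lambda>c k. (\<Sum>i<?l. c i * tensor_family w J B ! i $ k) = 0"
  let ?pair = "\<lambda>c a k. (\<Sum>i<?l. c i * w $$ (a, pick J i) * B $$ (k, i)) = 0"
  have split: "(\<forall>k < r * dim_row B. ?dep c k) \<longleftrightarrow> (\<forall>a<r. \<forall>k<dim_row B. ?pair c a k)" for c
  proof -
    have eq: "?dep c k \<longleftrightarrow> ?pair c (k div dim_row B) (k mod dim_row B)"
      if "k < r * dim_row B" for k
    proof -
      have "tensor_family w J B ! i $ k
          = w $$ (k div dim_row B, pick J i) * B $$ (k mod dim_row B, i)" if "i < ?l" for i
        by (rule tensor_family_index[of _ r]) (use \<open>k < _\<close> that w B J pick[OF that] in auto)
      then show ?thesis by (simp add: mult.assoc)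
    qed
    have "?pair c a k" if "\<forall>k < r * dim_row B. ?dep c k" "a < r" "k < dim_row B" for a k
    proof -
      have "a * dim_row B + k < Suc a * dim_row B" using that by simp
      also have "\<dots> \<le> r * dim_row B" using that by (intro mult_right_mono) auto
      finally have lt: "a * dim_row B + k < r * dim_row B" .
      show ?thesis using that(1) lt eq[OF lt] that(3) by auto
    qed
    moreover have "?dep c k" if "\<forall>a<r. \<forall>k<dim_row B. ?pair c a k" "k < r * dim_row B" for k
    proof -
      have "0 < dim_row B" using that(2) by (cases "dim_row B") auto
      then show ?thesis
        using that eq[OF that(2)] by (simp add: less_mult_imp_div_less)
    qed
    ultimately show ?thesis by blast
  qed
  have row: "(\<forall>k<dim_row B. ?pair c a k) \<longleftrightarrow>
      (\<exists>y. \<forall>i<?l. c i * w $$ (a, pick J i) = (\<Sum>b<r. y b * v $$ (b, pick J i)))" for c a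
    unfolding annihilates_gale_dual_iff[OF A gale, of "\<lambda>i. c i * w $$ (a, pick J i)"]
    by (simp add: A_index)
  have "lin_dep_family (r * dim_row B) (tensor_family w J B) \<longleftrightarrow>
      (\<exists>c. (\<exists>i<?l. c i \<noteq> 0) \<and> (\<forall>k < r * dim_row B. ?dep c k))"
    by (subst lin_dep_family_iff) (use w B in \<open>auto simp: tensor_family_def vec_tensor_def\<close>)
  also have "\<dots> \<longleftrightarrow> (\<exists>c g. (\<exists>i<?l. c i \<noteq> 0) \<and> (\<forall>a<r. \<forall>i<?l.
      c i * w $$ (a, pick J i) = (\<Sum>b<r. g a b * v $$ (b, pick J i))))"
    (is "_ \<longleftrightarrow> ?R")
    unfolding split row choice_iff' by simp
  also have "\<dots> \<longleftrightarrow> aligned_on r v w J"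
  proof
    assume ?R
    then obtain c g where cg: "\<exists>i<?l. c i \<noteq> 0" "\<forall>a<r. \<forall>i<?l.
      c i * w $$ (a, pick J i) = (\<Sum>b<r. g a b * v $$ (b, pick J i))" by blast
    \<comment> \<open>reindex from positions within \<open>J\<close> to elements of \<open>J\<close>\<close>
    define e where "e = (\<lambda>j. c (card {a\<in>J. a < j}))"
    have e: "e (pick J i) = c i" if "i < ?l" for i using that by (simp add: e_def card_pick_le)
    obtain i where i: "i < ?l" "c i \<noteq> 0" using cg(1) by blast
    have "\<exists>j\<in>J. e j \<noteq> 0"
      by (rule bexI[of _ "pick J i"]) (use i pick e in auto)
    moreover have "e j * w $$ (a, j) = (\<Sum>b<r. g a b * v $$ (b, j))" if j: "j \<in> J" and "a < r" for j a
    proof -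
      obtain i where "i < ?l" "j = pick J i" using surj[OF j] by blast
      then show ?thesis using e[of i] cg(2)[rule_format, OF \<open>a < r\<close>, of i] by (simp only:)
    qed
    ultimately show "aligned_on r v w J" unfolding aligned_on_def by blast
  next
    assume "aligned_on r v w J"
    then obtain c g where cg: "\<exists>j\<in>J. c j \<noteq> 0"
      "\<forall>j\<in>J. \<forall>a<r. c j * w $$ (a, j) = (\<Sum>b<r. g a b * v $$ (b, j))"
      unfolding aligned_on_def by blast
    obtain j where j: "j \<in> J" "c j \<noteq> 0" using cg(1) by blast
    obtain i where "i < ?l" "j = pick J i" using surj[OF j(1)] by blast
    then have "\<exists>i<?l. c (pick J i) \<noteq> 0" using j by blast
    then show ?R using cg(2) pick
      by (intro exI[of _ "\<lambda>i. c (pick J i)"] exI[of _ g]) simp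
  qed
  finally show ?thesis .
qed

section \<open>Regular functions on the space of matrices\<close>

definition eval_monomial :: "((nat \<times> nat) \<Rightarrow>\<^sub>0 nat) \<Rightarrow> ('a :: comm_semiring_1) mat \<Rightarrow> 'a" where
  "eval_monomial m x = (\<Prod>ij\<in>Poly_Mapping.keys m. x $$ ij ^ Poly_Mapping.lookup m ij)"

lemma eval_monomial_superset:
  assumes "finite K" "Poly_Mapping.keys m \<subseteq> K"
  shows "eval_monomial m x = (\<Prod>ij\<in>K. x $$ ij ^ Poly_Mapping.lookup m ij)"
  unfolding eval_monomial_def using assms
  by (intro prod.mono_neutral_left) (auto simp: in_keys_iff)

lemma eval_monomial_add: "eval_monomial (m + m') x = eval_monomial m x * eval_monomial m' x"
proof -
  let ?K = "Poly_Mapping.keys m \<union> Poly_Mapping.keys m'"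
  have "eval_monomial k x = (\<Prod>ij\<in>?K. x $$ ij ^ Poly_Mapping.lookup k ij)"
    if "Poly_Mapping.keys k \<subseteq> ?K" for k
    using that by (intro eval_monomial_superset) auto
  from this[of m] this[of m'] this[OF Poly_Mapping.keys_add] show ?thesis
    by (simp add: lookup_add power_add prod.distrib)
qed

lemma eval_entry_poly_superset:
  assumes "finite K" "Poly_Mapping.keys p \<subseteq> K"
  shows "eval_entry_poly p x = (\<Sum>m\<in>K. Poly_Mapping.lookup p m * eval_monomial m x)"
  unfolding eval_entry_poly_def eval_monomial_def[symmetric] using assms
  by (intro sum.mono_neutral_left) (auto simp: in_keys_iff)

lemma eval_entry_poly_add:
  "eval_entry_poly (p + q) x = eval_entry_poly p x + eval_entry_poly q x"
proof -
  let ?K = "Poly_Mapping.keys p \<union> Poly_Mapping.keys q"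
  have "eval_entry_poly u x = (\<Sum>m\<in>?K. Poly_Mapping.lookup u m * eval_monomial m x)"
    if "Poly_Mapping.keys u \<subseteq> ?K" for u
    using that by (intro eval_entry_poly_superset) auto
  from this[of p] this[of q] this[OF Poly_Mapping.keys_add] show ?thesis
    by (simp add: lookup_add distrib_right sum.distrib)
qed

lemma eval_entry_poly_single:
  "eval_entry_poly (Poly_Mapping.single m c) x = c * eval_monomial m x"
  by (subst eval_entry_poly_superset[of "{m}"]) auto

text \<open>
  Only the values on \<open>r\<close>-by-\<open>n\<close> matrices count, so that functions given by formulas such as
  determinants can be recognised as polynomial without naming a polynomial.
\<close>

definition regular_function :: "nat \<Rightarrow> nat \<Rightarrow> (('a :: comm_semiring_1) mat \<Rightarrow> 'a) \<Rightarrow> bool" where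
  "regular_function r n f \<longleftrightarrow>
     (\<exists>p\<in>entry_polys r n. \<forall>x\<in>carrier_mat r n. f x = eval_entry_poly p x)"

lemma regular_function_monomial:
  assumes "Poly_Mapping.keys m \<subseteq> {0..<r} \<times> {0..<n}"
  shows "regular_function r n (\<lambda>x. c * eval_monomial m x)"
  unfolding regular_function_def using assms
  by (intro bexI[of _ "Poly_Mapping.single m c"])
    (auto simp: eval_entry_poly_single entry_polys_def split: if_splits)

lemma regular_function_const: "regular_function r n (\<lambda>x. c)"
  using regular_function_monomial[of 0 r n c] by (simp add: eval_monomial_def)

lemma regular_function_entry:
  assumes "i < r" "j < n"
  shows "regular_function r n (\<lambda>x. x $$ (i, j))"
  using regular_function_monomial[of "Poly_Mapping.single (i, j) 1" r n 1] assms
  by (simp add: eval_monomial_def)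

lemma regular_function_add:
  assumes "regular_function r n f" "regular_function r n h"
  shows "regular_function r n (\<lambda>x. f x + h x)"
proof -
  obtain p q where "p \<in> entry_polys r n" "\<forall>x\<in>carrier_mat r n. f x = eval_entry_poly p x"
    "q \<in> entry_polys r n" "\<forall>x\<in>carrier_mat r n. h x = eval_entry_poly q x"
    using assms unfolding regular_function_def by blast
  moreover from this have "p + q \<in> entry_polys r n"
    using Poly_Mapping.keys_add[of p q] unfolding entry_polys_def by blast
  ultimately show ?thesis
    unfolding regular_function_def by (intro bexI[of _ "p + q"]) (simp_all add: eval_entry_poly_add)
qed

lemma regular_function_sum:
  "(\<And>i. i \<in> I \<Longrightarrow> regular_function r n (f i)) \<Longrightarrow> regular_function r n (\<lambda>x. \<Sum>i\<in>I. f i x)"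
  by (induction I rule: infinite_finite_induct)
    (simp_all add: regular_function_const regular_function_add)

lemma regular_function_mult:
  assumes "regular_function r n f" "regular_function r n h"
  shows "regular_function r n (\<lambda>x. f x * h x)"
proof -
  obtain p q where p: "p \<in> entry_polys r n" "\<forall>x\<in>carrier_mat r n. f x = eval_entry_poly p x"
    and q: "q \<in> entry_polys r n" "\<forall>x\<in>carrier_mat r n. h x = eval_entry_poly q x"
    using assms unfolding regular_function_def by blast
  have "regular_function r n (\<lambda>x. \<Sum>m\<in>Poly_Mapping.keys p. \<Sum>m'\<in>Poly_Mapping.keys q.
      (Poly_Mapping.lookup p m * Poly_Mapping.lookup q m') * eval_monomial (m + m') x)"
  proof (intro regular_function_sum regular_function_monomial)
    fix m m' assume "m \<in> Poly_Mapping.keys p" "m' \<in> Poly_Mapping.keys q"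
    then show "Poly_Mapping.keys (m + m') \<subseteq> {0..<r} \<times> {0..<n}"
      using p(1) q(1) Poly_Mapping.keys_add[of m m'] unfolding entry_polys_def by blast
  qed
  also have "(\<lambda>x. \<Sum>m\<in>Poly_Mapping.keys p. \<Sum>m'\<in>Poly_Mapping.keys q.
      (Poly_Mapping.lookup p m * Poly_Mapping.lookup q m') * eval_monomial (m + m') x)
    = (\<lambda>x. eval_entry_poly p x * eval_entry_poly q x)"
    by (simp add: eval_entry_poly_superset[OF finite_keys order_refl] sum_product
        eval_monomial_add mult_ac)
  finally show ?thesis
    using p(2) q(2) unfolding regular_function_def by (metis (no_types, lifting))
qed

lemma regular_function_prod:
  "(\<And>i. i \<in> I \<Longrightarrow> regular_function r n (f i)) \<Longrightarrow> regular_function r n (\<lambda>x. \<Prod>i\<in>I. f i x)"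
  by (induction I rule: infinite_finite_induct)
    (simp_all add: regular_function_const regular_function_mult)

lemma regular_function_det:
  fixes F :: "'a :: comm_ring_1 mat \<Rightarrow> nat \<Rightarrow> nat \<Rightarrow> 'a"
  assumes "\<And>i j. i < l \<Longrightarrow> j < l \<Longrightarrow> regular_function r n (\<lambda>x. F x i j)"
  shows "regular_function r n (\<lambda>x. det (mat l l (\<lambda>(i, j). F x i j)))"
proof -
  have "regular_function r n (\<lambda>x. \<Sum>\<pi> | \<pi> permutes {0..<l}.
      signof \<pi> * (\<Prod>i = 0..<l. F x i (\<pi> i)))"
    by (intro regular_function_sum regular_function_mult regular_function_const
        regular_function_prod assms) (auto dest: permutes_in_image)
  also have "(\<lambda>x. \<Sum>\<pi> | \<pi> permutes {0..<l}. signof \<pi> * (\<Prod>i = 0..<l. F x i (\<pi> i)))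
    = (\<lambda>x. det (mat l l (\<lambda>(i, j). F x i j)))"
    by (auto simp: det_def dest: permutes_in_image intro!: sum.cong prod.cong arg_cong2[of _ _ _ _ "(*)"])
  finally show ?thesis .
qed

text \<open>
  A closed set is an intersection of zero sets of single polynomials, so these suffice to test
  membership in the closure.
\<close>

lemma mem_zariski_closure_iff:
  assumes "S \<subseteq> carrier_mat r n"
  shows "w \<in> zariski_closure r n S \<longleftrightarrow> w \<in> carrier_mat r n \<and>
    (\<forall>p\<in>entry_polys r n. (\<forall>x\<in>S. eval_entry_poly p x = 0) \<longrightarrow> eval_entry_poly p w = 0)"
    (is "_ \<longleftrightarrow> ?R")
proof
  assume w: "w \<in> zariski_closure r n S"
  let ?Z = "\<lambda>P. {x \<in> carrier_mat r n. \<forall>p\<in>P. eval_entry_poly p x = 0}"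
  have "w \<in> ?Z P" if "P \<subseteq> entry_polys r n" "S \<subseteq> ?Z P" for P
    using w that unfolding zariski_closure_def zariski_closed_def by blast
  from this[of "{}"] this[of "{p}" for p] show ?R using assms by blast
next
  assume ?R
  then show "w \<in> zariski_closure r n S"
    unfolding zariski_closure_def zariski_closed_def by blast
qed

lemma regular_function_zero_on_closure:
  assumes S: "S \<subseteq> carrier_mat r n" and w: "w \<in> zariski_closure r n S"
    and f: "regular_function r n f" and zero: "\<And>x. x \<in> S \<Longrightarrow> f x = 0"
  shows "f w = 0"
proof -
  obtain p where p: "p \<in> entry_polys r n" "\<forall>x\<in>carrier_mat r n. f x = eval_entry_poly p x"
    using f unfolding regular_function_def by blast
  then have "\<forall>x\<in>S. eval_entry_poly p x = 0" using S zero by (metis subsetD)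
  then show ?thesis using w p unfolding mem_zariski_closure_iff[OF S] by simp
qed

section \<open>Linear dependence is a closed condition\<close>

text \<open>
  If the vectors are independent at \<open>w\<close>, then the matrix with these columns has a left inverse \<open>L\<close>
  at \<open>w\<close>. With this constant \<open>L\<close>, the determinant of \<open>L\<close> times the varying matrix is a regular
  function that is 1 at \<open>w\<close> and 0 wherever the vectors are dependent.
\<close>

lemma linear_dependence_closed:
  fixes X :: "'a :: field mat \<Rightarrow> nat \<Rightarrow> nat \<Rightarrow> 'a"
  assumes S: "S \<subseteq> carrier_mat r n" and w: "w \<in> zariski_closure r n S"
    and X: "\<And>i k. i < l \<Longrightarrow> k < d \<Longrightarrow> regular_function r n (\<lambda>x. X x i k)"
    and dep: "\<And>x. x \<in> S \<Longrightarrow> \<exists>c. (\<exists>i<l. c i \<noteq> 0) \<and> (\<forall>k<d. (\<Sum>i<l. c i * X x i k) = 0)"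
  shows "\<exists>c. (\<exists>i<l. c i \<noteq> 0) \<and> (\<forall>k<d. (\<Sum>i<l. c i * X w i k) = 0)"
proof (rule ccontr)
  assume "\<not> ?thesis"
  then have indep: "\<forall>i<l. c i = 0" if "\<forall>k<d. (\<Sum>i<l. c i * X w i k) = 0" for c
    using that by blast
  have "\<exists>y. \<forall>j\<in>{..<l}. (if j = i then 1 else 0) = (\<Sum>k<d. y k * X w j k)" if "i < l" for i
  proof (rule in_span_if_vanishes_on_common_kernel)
    fix z assume "\<forall>k<d. (\<Sum>j<l. X w j k * z j) = 0"
    then have "\<forall>i<l. z i = 0" by (intro indep) (simp add: mult.commute)
    then show "(\<Sum>j<l. (if j = i then 1 else 0) * z j) = 0" by simp
  qed simp
  then obtain L where L:
    "\<And>i j. i < l \<Longrightarrow> j < l \<Longrightarrow> (if j = i then 1 else 0) = (\<Sum>k<d. L i k * X w j k)"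
    by (metis lessThan_iff)
  let ?LX = "\<lambda>x. mat l l (\<lambda>(i, j). \<Sum>k<d. L i k * X x j k)"
  have "det (?LX w) = 0"
  proof (rule regular_function_zero_on_closure[OF S w])
    show "regular_function r n (\<lambda>x. det (?LX x))"
      by (intro regular_function_det regular_function_sum regular_function_mult
          regular_function_const X) auto
    fix x assume "x \<in> S"
    then obtain c where c: "\<exists>i<l. c i \<noteq> 0" "\<forall>k<d. (\<Sum>i<l. c i * X x i k) = 0"
      using dep by blast
    have "(\<Sum>j<l. (\<Sum>k<d. L i k * X x j k) * c j) = 0" for i
    proof -
      have "(\<Sum>j<l. (\<Sum>k<d. L i k * X x j k) * c j) = (\<Sum>j<l. \<Sum>k<d. L i k * (c j * X x j k))"
        by (simp add: sum_distrib_left sum_distrib_right mult_ac)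
      also have "\<dots> = (\<Sum>k<d. L i k * (\<Sum>j<l. c j * X x j k))"
        by (subst sum.swap) (simp add: sum_distrib_left)
      finally show ?thesis using c(2) by simp
    qed
    then have "?LX x *\<^sub>v vec l c = 0\<^sub>v l"
      by (intro eq_vecI) (simp_all add: scalar_prod_def lessThan_atLeast0)
    moreover have "vec l c \<noteq> 0\<^sub>v l" using c(1) by (metis index_vec index_zero_vec(1))
    ultimately show "det (?LX x) = 0"
      by (subst det_0_iff_vec_prod_zero_field[of _ l]) (auto intro!: exI[of _ "vec l c"])
  qed
  moreover have "?LX w = 1\<^sub>m l" using L by (intro eq_matI) (auto simp flip: L)
  ultimately show False by simp
qed

section \<open>Orbit closures and polynomial curves\<close>

text \<open>
  Along a polynomial curve \<open>p\<close> becomes a polynomial in the parameter, and this polynomial has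
  infinitely many zeros.
\<close>

lemma eval_entry_poly_on_curve:
  fixes Q :: "nat \<times> nat \<Rightarrow> 'a :: field_char_0 poly"
  assumes p: "p \<in> entry_polys r n" and F: "finite F"
    and zero: "\<And>t. t \<notin> F \<Longrightarrow> eval_entry_poly p (mat r n (\<lambda>ij. poly (Q ij) t)) = 0"
  shows "eval_entry_poly p (mat r n (\<lambda>ij. poly (Q ij) t)) = 0"
proof -
  define P where "P = (\<Sum>m\<in>Poly_Mapping.keys p. [:Poly_Mapping.lookup p m:] *
      (\<Prod>ij\<in>Poly_Mapping.keys m. Q ij ^ Poly_Mapping.lookup m ij))"
  have P: "eval_entry_poly p (mat r n (\<lambda>ij. poly (Q ij) t)) = poly P t" for t
    unfolding P_def eval_entry_poly_def poly_sum poly_mult poly_prod poly_power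
  proof (intro sum.cong refl arg_cong2[of _ _ _ _ "(*)"] prod.cong)
    fix m ij assume "m \<in> Poly_Mapping.keys p" "ij \<in> Poly_Mapping.keys m"
    then have "ij \<in> {0..<r} \<times> {0..<n}" using p unfolding entry_polys_def by blast
    then show "mat r n (\<lambda>ij. poly (Q ij) t) $$ ij ^ Poly_Mapping.lookup m ij
        = poly (Q ij) t ^ Poly_Mapping.lookup m ij" by auto
  qed simp
  have "P = 0"
  proof (rule ccontr)
    assume "P \<noteq> 0"
    then have "finite (F \<union> {t. poly P t = 0})" using F by (simp add: poly_roots_finite)
    moreover have "F \<union> {t. poly P t = 0} = UNIV" using zero P by auto
    ultimately show False using infinite_UNIV_char_0[where 'a = 'a] by simp
  qed
  then show ?thesis by (simp add: P)
qed

lemma matrix_orbit_subset_carrier: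
  assumes v: "v \<in> carrier_mat r n"
  shows "matrix_orbit r n v \<subseteq> carrier_mat r n"
  unfolding matrix_orbit_def using mult_carrier_mat[OF mult_carrier_mat[OF _ v] mat_diag_dim] by blast

text \<open>
  Unlike for points of the orbit, \<open>g\<close> may be singular here; the result is still in the orbit closure
  if \<open>t\<close> has no zeros.
\<close>

definition translate :: "nat \<Rightarrow> nat \<Rightarrow> (nat \<Rightarrow> nat \<Rightarrow> 'a) \<Rightarrow> (nat \<Rightarrow> 'a) \<Rightarrow> ('a :: field) mat \<Rightarrow> 'a mat" where
  "translate r n g t v = mat r n (\<lambda>(a, j). (\<Sum>b<r. g a b * v $$ (b, j)) * t j)"

lemma translate_eq:
  assumes "v \<in> carrier_mat r n"
  shows "translate r n g t v = mat r r (\<lambda>(a, b). g a b) * v * mat_diag n t"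
  using assms unfolding translate_def
  by (subst mat_diag_mult_right[of _ r n])
    (auto intro!: eq_matI simp: scalar_prod_def lessThan_atLeast0)

lemma invertible_mat_if_det_nonzero:
  fixes A :: "'a :: field mat"
  assumes A: "A \<in> carrier_mat r r" and "det A \<noteq> 0"
  shows "invertible_mat A"
proof -
  obtain B where "B \<in> carrier_mat r r" "A * B = 1\<^sub>m r" "B * A = 1\<^sub>m r"
    using det_non_zero_imp_unit[OF assms] unfolding Units_def ring_mat_def by auto
  then show ?thesis
    using A unfolding invertible_mat_def inverts_mat_def by auto
qed

text \<open>
  The matrix \<open>g + s I\<close> is invertible unless \<open>- s\<close> is an eigenvalue of \<open>g\<close>, so only finitely many
  points of the line of the \<open>(g + s I) v diag(t)\<close> can be outside the orbit.
\<close>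

lemma eval_zero_on_translate:
  fixes v :: "'a :: field_char_0 mat"
  assumes v: "v \<in> carrier_mat r n" and t: "\<forall>j<n. t j \<noteq> 0"
    and p: "p \<in> entry_polys r n"
    and zero: "\<And>x. x \<in> matrix_orbit r n v \<Longrightarrow> eval_entry_poly p x = 0"
  shows "eval_entry_poly p (translate r n g t v) = 0"
proof -
  let ?g = "mat r r (\<lambda>(a, b). g a b)"
  let ?g' = "\<lambda>s a b. g a b + (if a = b then s else 0)"
  \<comment> \<open>the entries of \<open>(g + s I) v diag(t)\<close>, linear in \<open>s\<close>\<close>
  define Q where "Q = (\<lambda>(a, j). [:(\<Sum>b<r. g a b * v $$ (b, j)) * t j, v $$ (a, j) * t j:])"
  have "(\<Sum>b<r. ?g' s a b * v $$ (b, j)) = (\<Sum>b<r. g a b * v $$ (b, j)) + s * v $$ (a, j)"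
    if "a < r" for s a j
    using that by (simp add: distrib_right sum.distrib if_distrib[of "\<lambda>x. x * _"] cong: if_cong)
  then have curve: "mat r n (\<lambda>ij. poly (Q ij) s) = translate r n (?g' s) t v" for s
    unfolding translate_def Q_def by (intro eq_matI) (auto simp: distrib_right mult.assoc)
  have "eval_entry_poly p (mat r n (\<lambda>ij. poly (Q ij) 0)) = 0"
  proof (rule eval_entry_poly_on_curve[OF p])
    have "char_poly ?g \<noteq> 0" using degree_monic_char_poly[of ?g r] by fastforce
    then have "finite {s. poly (char_poly ?g) s = 0}" by (rule poly_roots_finite)
    then show "finite (uminus ` {s. poly (char_poly ?g) s = 0})" by simp
    fix s assume "s \<notin> uminus ` {s. poly (char_poly ?g) s = 0}"
    then have "poly (char_poly ?g) (- s) \<noteq> 0" by force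
    then have "det (char_matrix ?g (- s)) \<noteq> 0"
      using eigenvalue_root_char_poly[of ?g r] eigenvalue_det[of ?g r] by simp
    moreover have "char_matrix ?g (- s) = mat r r (\<lambda>(a, b). ?g' s a b)"
      unfolding char_matrix_def by (intro eq_matI) auto
    ultimately have "invertible_mat (mat r r (\<lambda>(a, b). ?g' s a b))"
      by (intro invertible_mat_if_det_nonzero[of _ r]) auto
    then have "translate r n (?g' s) t v \<in> matrix_orbit r n v"
      unfolding translate_eq[OF v] matrix_orbit_def using t by fastforce
    then show "eval_entry_poly p (mat r n (\<lambda>ij. poly (Q ij) s)) = 0"
      unfolding curve by (rule zero)
  qed
  then show ?thesis unfolding curve by (simp cong: if_cong)
qed

section \<open>Degeneration to an aligned matrix\<close>

text \<open>
  The curve that approaches \<open>w\<close>: column \<open>j\<close> of \<open>G v\<close> is \<open>c j * s ^ e j\<close> times a polynomial vector whose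
  value at \<open>s = 0\<close> is column \<open>j\<close> of \<open>w\<close>. In the induction, alignment on all of \<open>J\<close> gives a matrix \<open>g\<close>
  and factors, some of them nonzero, and the columns with nonzero factors are right already at
  order 0. The columns with factor 0 form a smaller set, and \<open>g\<close> kills them in \<open>v\<close>. Hence the curve \<open>G'\<close>
  for the smaller set can be added at the next order, as \<open>G = g + s G'\<close>, which raises the exponents
  of these columns by 1.
\<close>

lemma degeneration_if_aligned:
  fixes v w :: "'a :: field mat"
  assumes "finite J" and "\<And>I. I \<subseteq> J \<Longrightarrow> I \<noteq> {} \<Longrightarrow> aligned_on r v w I"
  shows "\<exists>G c e X. \<forall>j\<in>J. c j \<noteq> 0 \<and> (\<forall>a<r. poly (X a j) 0 = w $$ (a, j) \<and>
    (\<Sum>b<r. G a b * [:v $$ (b, j):]) = smult (c j) (monom 1 (e j) * X a j))"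
  using assms
proof (induction J rule: finite_psubset_induct)
  case (psubset J)
  show ?case
  proof (cases "J = {}")
    case False
    then obtain c g where c: "\<exists>j\<in>J. c j \<noteq> 0"
      and g: "\<And>j a. j \<in> J \<Longrightarrow> a < r \<Longrightarrow> c j * w $$ (a, j) = (\<Sum>b<r. g a b * v $$ (b, j))"
      using psubset.prems[of J] unfolding aligned_on_def by blast
    let ?K = "{j \<in> J. c j = 0}"
    have "?K \<subset> J" using c by blast
    moreover have "aligned_on r v w I" if "I \<subseteq> ?K" "I \<noteq> {}" for I
      using psubset.prems that by blast
    ultimately obtain G' c' e' X' where IH: "\<forall>j\<in>?K. c' j \<noteq> 0 \<and> (\<forall>a<r.
        poly (X' a j) 0 = w $$ (a, j) \<and>
        (\<Sum>b<r. G' a b * [:v $$ (b, j):]) = smult (c' j) (monom 1 (e' j) * X' a j))"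
      using psubset.IH[of ?K] by (elim exE meta_impE) auto
    define G where "G = (\<lambda>a b. [:g a b:] + monom 1 1 * G' a b)"
    define d where "d = (\<lambda>j. if c j = 0 then c' j else c j)"
    define e where "e = (\<lambda>j. if c j = 0 then Suc (e' j) else 0)"
    \<comment> \<open>where \<open>c j \<noteq> 0\<close> the exponent is 0, so the equation for \<open>G\<close> determines \<open>X\<close>\<close>
    define X where "X = (\<lambda>a j. if c j = 0 then X' a j
      else smult (inverse (c j)) (\<Sum>b<r. G a b * [:v $$ (b, j):]))"
    have split: "(\<Sum>b<r. G a b * [:v $$ (b, j):])
        = [:\<Sum>b<r. g a b * v $$ (b, j):] + monom 1 1 * (\<Sum>b<r. G' a b * [:v $$ (b, j):])" for a j
    proof -
      have "(\<Sum>b<r. [:g a b * v $$ (b, j):]) = [:\<Sum>b<r. g a b * v $$ (b, j):]"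
        by (rule poly_eqI) (simp add: coeff_sum coeff_pCons split: nat.split)
      moreover have "(\<Sum>b<r. G a b * [:v $$ (b, j):])
          = (\<Sum>b<r. [:g a b * v $$ (b, j):]) + (\<Sum>b<r. monom 1 1 * (G' a b * [:v $$ (b, j):]))"
        by (simp add: G_def distrib_right sum.distrib mult.assoc del: mult_pCons_right)
      ultimately show ?thesis by (simp only: sum_distrib_left)
    qed
    have "d j \<noteq> 0 \<and> (\<forall>a<r. poly (X a j) 0 = w $$ (a, j) \<and>
      (\<Sum>b<r. G a b * [:v $$ (b, j):]) = smult (d j) (monom 1 (e j) * X a j))" if j: "j \<in> J" for j
    proof (cases "c j = 0")
      case True
      then have "j \<in> ?K" using j by simp
      then show ?thesis
        using IH[rule_format, of j] g[OF j, symmetric] True unfolding split d_def e_def X_def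
        by (simp add: monom_Suc mult_ac flip: mult_monom)
    next
      case False
      have "poly (\<Sum>b<r. G a b * [:v $$ (b, j):]) 0 = c j * w $$ (a, j)" if "a < r" for a
        unfolding split using g[OF j that] by (simp add: poly_monom)
      then show ?thesis
        using False unfolding d_def e_def X_def by simp
    qed
    then show ?thesis by blast
  qed simp
qed

lemma in_orbit_closure_if_aligned:
  fixes v w :: "'a :: field_char_0 mat"
  assumes v: "v \<in> carrier_mat r n" and w: "w \<in> carrier_mat r n"
    and aligned: "\<And>J. J \<subseteq> {0..<n} \<Longrightarrow> J \<noteq> {} \<Longrightarrow> aligned_on r v w J"
  shows "w \<in> matrix_orbit_closure r n v"
proof -
  note orbit = matrix_orbit_subset_carrier[OF v]
  have "\<exists>G c e X. \<forall>j\<in>{0..<n}. c j \<noteq> 0 \<and> (\<forall>a<r. poly (X a j) 0 = w $$ (a, j) \<and>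
    (\<Sum>b<r. G a b * [:v $$ (b, j):]) = smult (c j) (monom 1 (e j) * X a j))"
    by (rule degeneration_if_aligned) (simp_all add: aligned)
  then obtain G c e X where GcX: "\<forall>j\<in>{0..<n}. c j \<noteq> 0 \<and> (\<forall>a<r. poly (X a j) 0 = w $$ (a, j) \<and>
    (\<Sum>b<r. G a b * [:v $$ (b, j):]) = smult (c j) (monom 1 (e j) * X a j))"
    by (elim exE) (rule that)
  then have c: "\<And>j. j < n \<Longrightarrow> c j \<noteq> 0"
    and limit: "\<And>a j. a < r \<Longrightarrow> j < n \<Longrightarrow> poly (X a j) 0 = w $$ (a, j)"
    and G: "\<And>a j. a < r \<Longrightarrow> j < n \<Longrightarrow>
      (\<Sum>b<r. G a b * [:v $$ (b, j):]) = smult (c j) (monom 1 (e j) * X a j)"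
    by simp_all
  show ?thesis
    unfolding matrix_orbit_closure_def mem_zariski_closure_iff[OF orbit]
  proof (intro conjI w ballI impI)
    fix p assume p: "p \<in> entry_polys r n" "\<forall>x\<in>matrix_orbit r n v. eval_entry_poly p x = 0"
    have "eval_entry_poly p (mat r n (\<lambda>ij. poly (case ij of (a, j) \<Rightarrow> X a j) 0)) = 0"
      \<comment> \<open>the scalars of the columns can have poles at \<open>s = 0\<close> only\<close>
    proof (rule eval_entry_poly_on_curve[OF p(1), of "{0}"])
      fix s :: 'a assume "s \<notin> {0}"
      then have s: "s \<noteq> 0" by simp
      have "poly (X a j) s = (\<Sum>b<r. poly (G a b) s * v $$ (b, j)) * inverse (c j * s ^ e j)"
        if "a < r" "j < n" for a j
      proof -
        have "(\<Sum>b<r. poly (G a b) s * v $$ (b, j)) = c j * s ^ e j * poly (X a j) s"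
          using arg_cong[OF G[OF that], of "\<lambda>q. poly q s"]
          by (simp add: poly_sum poly_monom mult_ac)
        then show ?thesis using s c[OF that(2)] by (simp add: field_simps)
      qed
      then have "mat r n (\<lambda>ij. poly (case ij of (a, j) \<Rightarrow> X a j) s)
          = translate r n (\<lambda>a b. poly (G a b) s) (\<lambda>j. inverse (c j * s ^ e j)) v"
        unfolding translate_def by (intro eq_matI) auto
      moreover have "\<forall>j<n. inverse (c j * s ^ e j) \<noteq> 0" using s c by simp
      ultimately show "eval_entry_poly p (mat r n (\<lambda>ij. poly (case ij of (a, j) \<Rightarrow> X a j) s)) = 0"
        using eval_zero_on_translate[OF v _ p(1)] p(2) by simp
    qed simp
    moreover have "mat r n (\<lambda>ij. poly (case ij of (a, j) \<Rightarrow> X a j) 0) = w"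
      using w limit by (intro eq_matI) auto
    ultimately show "eval_entry_poly p w = 0" by simp
  qed
qed

section \<open>Tensor equations of the orbit closure\<close>

lemma aligned_on_if_in_orbit:
  assumes v: "v \<in> carrier_mat r n" and x: "x \<in> matrix_orbit r n v"
    and J: "J \<subseteq> {0..<n}" "J \<noteq> {}"
  shows "aligned_on r v x J"
proof -
  obtain g t where g: "g \<in> carrier_mat r r" and t: "\<forall>j<n. t j \<noteq> 0" and x: "x = g * v * mat_diag n t"
    using x unfolding matrix_orbit_def by blast
  have "inverse (t j) * x $$ (a, j) = (\<Sum>b<r. g $$ (a, b) * v $$ (b, j))" if "j < n" "a < r" for j a
    using that g v t unfolding x
    by (subst mat_diag_mult_right[of _ r n]) (auto simp: scalar_prod_def lessThan_atLeast0)
  moreover have "\<exists>j\<in>J. inverse (t j) \<noteq> 0" using J t by fastforce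
  ultimately show ?thesis
    unfolding aligned_on_def using J(1)
    by (intro exI[of _ "\<lambda>j. inverse (t j)"] exI[of _ "\<lambda>a b. g $$ (a, b)"]) auto
qed

text \<open>
  The entries of the tensors are constant multiples of entries of \<open>w\<close>, so their dependence is a
  closed condition on \<open>w\<close>.
\<close>

lemma tensor_family_closed:
  fixes S :: "'a :: field mat set"
  assumes S: "S \<subseteq> carrier_mat r n" and w: "w \<in> zariski_closure r n S"
    and J: "J \<subseteq> {0..<n}" and B: "dim_col B = card J"
    and dep: "\<And>x. x \<in> S \<Longrightarrow> lin_dep_family (r * dim_row B) (tensor_family x J B)"
  shows "lin_dep_family (r * dim_row B) (tensor_family w J B)"
proof -
  let ?d = "r * dim_row B"
  have pick: "pick J i < n" if "i < card J" for i
    using that J pick_in_set_le[of i J] by auto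
  have iff: "lin_dep_family ?d (tensor_family x J B) \<longleftrightarrow>
      (\<exists>c. (\<exists>i<card J. c i \<noteq> 0) \<and> (\<forall>k<?d. (\<Sum>i<card J. c i *
        (x $$ (k div dim_row B, pick J i) * B $$ (k mod dim_row B, i))) = 0))"
    if "x \<in> carrier_mat r n" for x
  proof -
    have "tensor_family x J B ! i $ k = x $$ (k div dim_row B, pick J i) * B $$ (k mod dim_row B, i)"
      if "i < card J" "k < ?d" for i k
      by (rule tensor_family_index[of _ r]) (use \<open>x \<in> _\<close> that B pick in auto)
    moreover have "\<forall>y\<in>set (tensor_family x J B). dim_vec y = ?d"
      using that by (auto simp: tensor_family_def vec_tensor_def)
    moreover have "length (tensor_family x J B) = card J" by (simp add: tensor_family_def)
    ultimately show ?thesis by (simp add: lin_dep_family_iff)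
  qed
  have w_carrier: "w \<in> carrier_mat r n" using w mem_zariski_closure_iff[OF S] by blast
  show ?thesis
    unfolding iff[OF w_carrier]
  proof (rule linear_dependence_closed[OF S w])
    show "regular_function r n
        (\<lambda>x. x $$ (k div dim_row B, pick J i) * B $$ (k mod dim_row B, i))"
      if "i < card J" "k < ?d" for i k
      using that pick
      by (intro regular_function_mult regular_function_const regular_function_entry)
        (simp_all add: less_mult_imp_div_less)
  qed (use dep iff S in blast)
qed

theorem theorem4p2:
  fixes v w :: "'k :: {alg_closed_field, field_char_0} mat"
    and r n :: nat
    and D :: "nat set \<Rightarrow> 'k mat"
  assumes "v \<in> carrier_mat r n"
    and "w \<in> carrier_mat r n"
    and "\<And>J. J \<subseteq> {0..<n} \<Longrightarrow> J \<noteq> {} \<Longrightarrow> gale_dual (column_submatrix v J) (D J)"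
  shows "w \<in> matrix_orbit_closure r n v \<longleftrightarrow>
    (\<forall>J. J \<subseteq> {0..<n} \<and> J \<noteq> {} \<longrightarrow>
      lin_dep_family (r * (card J - mat_rank (column_submatrix v J))) (tensor_family w J (D J)))"
proof -
  note orbit = matrix_orbit_subset_carrier[OF assms(1)]
  have dims: "dim_row (D J) = card J - mat_rank (column_submatrix v J)" "dim_col (D J) = card J"
    if J: "J \<subseteq> {0..<n}" "J \<noteq> {}" for J
  proof -
    have "{j. j < n \<and> j \<in> J} = J" using J by auto
    then have "dim_col (column_submatrix v J) = card J"
      using assms(1) by (simp add: column_submatrix_def dim_submatrix)
    then show "dim_row (D J) = card J - mat_rank (column_submatrix v J)" "dim_col (D J) = card J"
      using assms(3)[OF J] unfolding gale_dual_def by auto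
  qed
  note dep_iff = lin_dep_tensor_family_iff[OF assms(1) _ _ assms(3)]
  have "w \<in> matrix_orbit_closure r n v \<longleftrightarrow>
    (\<forall>J. J \<subseteq> {0..<n} \<and> J \<noteq> {} \<longrightarrow>
      lin_dep_family (r * dim_row (D J)) (tensor_family w J (D J)))"
  proof (intro iffI allI impI)
    fix J assume w: "w \<in> matrix_orbit_closure r n v" and "J \<subseteq> {0..<n} \<and> J \<noteq> {}"
    then have J: "J \<subseteq> {0..<n}" "J \<noteq> {}" by auto
    have "lin_dep_family (r * dim_row (D J)) (tensor_family x J (D J))"
      if "x \<in> matrix_orbit r n v" for x
      using dep_iff[of x J] aligned_on_if_in_orbit[OF assms(1) that J] orbit that J by blast
    then show "lin_dep_family (r * dim_row (D J)) (tensor_family w J (D J))"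
      using tensor_family_closed[OF orbit _ J(1) dims(2)[OF J]] w
      unfolding matrix_orbit_closure_def by blast
  next
    assume "\<forall>J. J \<subseteq> {0..<n} \<and> J \<noteq> {} \<longrightarrow>
      lin_dep_family (r * dim_row (D J)) (tensor_family w J (D J))"
    then show "w \<in> matrix_orbit_closure r n v"
      using dep_iff[OF assms(2)] by (intro in_orbit_closure_if_aligned assms(1,2)) blast
  qed
  then show ?thesis using dims(1) by simp
qed

end
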